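(* Let $p\in\mathbb{N}^*$. If $a,c\in\ell(\mathbb{K}^*;p)$ and $b\in\ell(\mathbb{K};p)$, the difference equation $$a(k)z(k+1)-b(k)z(k)+c(k-1)z(k-1)=0,\qquad k\in\mathbb{Z},$$ has non-null periodic solutions $z\in\ell(\mathbb{K};p)$ with period $p$ if and only if $$a^{\pi_p}+c^{\pi_p}=\sum_{j=0}^{\lfloor p/2\rfloor}(-1)^j\sum_{\alpha\in\Lambda_p^j}a^{\alpha}\,b^{\bar\alpha}\,c^{\alpha}.$$
   Context: $\mathbb{K}$ denotes either $\mathbb{R}$ or $\mathbb{C}$, $\mathbb{N}^*=\{1,2,\dots\}$. $\ell(\mathbb{K};p)$ is the set of sequences $z:\mathbb{Z}\to\mathbb{K}$ with $z(k+p)=z(k)$ for all $k\in\mathbb{Z}$; $\ell(\mathbb{K}^*;p)$ is the subset of those that never vanish. Multi-indices. A binary multi-index of order $p$ is $\alpha=(\alpha_0,\dots,\alpha_{p-1})\in\{0,1\}^p$, with $|\alpha|=\sum_{j=0}^{p-1}\alpha_j$; $\pi_p=(1,\dots,1)$. For a sequence $a$, $a^\alpha=\prod_{j=0}^{p-1}a(j)^{\alpha_j}$ with $0^0=1$ (so $a^{\pi_p}=\prod_{j=0}^{p-1}a(j)$). When $|\alpha|=m$, let $0\le i_1<\dots<i_m\le p-1$ be the indices with $\alpha_{i_1}=\dots=\alpha_{i_m}=1$. Define $\Lambda_p^0=\{(0,\dots,0)\}$; for $p\ge2$, $\Lambda_p^1=\{\alpha\in\{0,1\}^p:|\alpha|=1\}$;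 for $p\ge4$ and $2\le m\le\lfloor p/2\rfloor$, $\Lambda_p^m$ is the set of $\alpha\in\{0,1\}^p$ with $|\alpha|=m$, $i_{j+1}-i_j\ge2$ for $j=1,\dots,m-1$, and $i_m\le p-2$ when $i_1=0$. For $\alpha\in\Lambda_p^m$ with $m\ge1$, $\bar\alpha\in\{0,1\}^p$ is defined by $\bar\alpha_{i_j}=\bar\alpha_{i_j+1}=0$ for $j=1,\dots,m$ and $\bar\alpha_i=1$ otherwise, where if $i_m=p-1$ the index $i_m+1$ is read as $0$; for $\alpha=(0,\dots,0)$, $\bar\alpha=\pi_p$. *)

theory Defs
  imports Complex_Main "HOL-Library.FuncSet"
begin

definition per_seq :: "nat \<Rightarrow> (int \<Rightarrow> 'a) set" where
  "per_seq p = {z. \<forall>k. z (k + int p) = z k}"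

definition per_seq_nz :: "nat \<Rightarrow> (int \<Rightarrow> 'a::zero) set" where
  "per_seq_nz p = {z \<in> per_seq p. \<forall>k. z k \<noteq> 0}"

text \<open>A multi-index of order \<open>p\<close> is a function on \<open>{..<p}\<close> that is \<open>undefined\<close> elsewhere,
  so that each element of \<open>{0,1}\<^sup>p\<close> is represented exactly once.\<close>

definition multi_index :: "nat \<Rightarrow> (nat \<Rightarrow> nat) set" where
  "multi_index p = ({..<p} \<rightarrow>\<^sub>E {0, 1})"

definition mi_abs :: "nat \<Rightarrow> (nat \<Rightarrow> nat) \<Rightarrow> nat" where
  "mi_abs p \<alpha> = (\<Sum>j<p. \<alpha> j)"

definition mi_zero :: "nat \<Rightarrow> nat \<Rightarrow> nat" where
  "mi_zero p = (\<lambda>j\<in>{..<p}. 0)"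

definition mi_ones :: "nat \<Rightarrow> nat \<Rightarrow> nat" where
  "mi_ones p = (\<lambda>j\<in>{..<p}. 1)"

definition mi_power :: "nat \<Rightarrow> (int \<Rightarrow> 'a::comm_monoid_mult) \<Rightarrow> (nat \<Rightarrow> nat) \<Rightarrow> 'a" where
  "mi_power p a \<alpha> = (\<Prod>j<p. a (int j) ^ \<alpha> j)"

text \<open>The increasing list of the positions \<open>i\<^sub>1 < \<dots> < i\<^sub>m\<close> of the ones. List positions start at
  \<open>0\<close>, so \<open>mi_supp p \<alpha> ! j\<close> is \<open>i\<close> with subscript \<open>j + 1\<close>.\<close>

definition mi_supp :: "nat \<Rightarrow> (nat \<Rightarrow> nat) \<Rightarrow> nat list" where
  "mi_supp p \<alpha> = sorted_list_of_set {i. i < p \<and> \<alpha> i = 1}"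

text \<open>The sets \<open>\<Lambda>\<close> are only meant for \<open>m \<le> p div 2\<close>; they are empty by convention otherwise.
  Inequalities between indices are written additively to avoid truncated subtraction.\<close>

definition Lam :: "nat \<Rightarrow> nat \<Rightarrow> (nat \<Rightarrow> nat) set" where
  "Lam p m =
    (if m = 0 then {mi_zero p}
     else if m = 1 \<and> 2 \<le> p then {\<alpha> \<in> multi_index p. mi_abs p \<alpha> = 1}
     else if 2 \<le> m \<and> m \<le> p div 2 then
       {\<alpha> \<in> multi_index p. mi_abs p \<alpha> = m \<and>
          (\<forall>j. j + 1 < m \<longrightarrow> mi_supp p \<alpha> ! j + 2 \<le> mi_supp p \<alpha> ! (j + 1)) \<and>
          (mi_supp p \<alpha> ! 0 = 0 \<longrightarrow> mi_supp p \<alpha> ! (m - 1) + 2 \<le> p)}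
     else {})"

text \<open>The reduction modulo \<open>p\<close> reads the index \<open>p\<close> as \<open>0\<close>.\<close>

definition mi_bar :: "nat \<Rightarrow> (nat \<Rightarrow> nat) \<Rightarrow> nat \<Rightarrow> nat" where
  "mi_bar p \<alpha> = (\<lambda>i\<in>{..<p}.
     if \<exists>s \<in> set (mi_supp p \<alpha>). i = s \<or> i = (s + 1) mod p then 0 else 1)"

end

theory Submission imports Defs begin

text \<open>A solution of the recurrence is determined by \<open>x = z(0)\<close> and \<open>y = z(-1)\<close>. Multiplying \<open>z(n)\<close> by
  \<open>a(0) \<cdots> a(n-1)\<close> clears the divisions by \<open>a\<close> and yields a sequence with
  \<open>u(n+2) = b(n+1) u(n+1) + w(n) u(n)\<close>, where \<open>w(n) = - a(n) c(n)\<close>. If \<open>K\<close> and \<open>L\<close> denote the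
  solutions of this recurrence that start with \<open>1, b(0)\<close> and \<open>0, 1\<close>, then
  \<open>u(n) = x K(n) - c(-1) y L(n)\<close>. Periodicity of \<open>z\<close> only has to be imposed on the two
  values \<open>z(p) = x\<close> and \<open>z(p-1) = y\<close>, which is a homogeneous \<open>2 \<times> 2\<close> system for
  \<open>(x, y)\<close>. The Casoratian identity for \<open>K\<close> and \<open>L\<close> evaluates its determinant: up to a non-zero factor
  it is the product of all \<open>a(j)\<close> plus the product of all \<open>c(j)\<close> minus
  \<open>K(p) + w(p-1) L(p-1)\<close>. The last expression is the trace of the monodromy matrix, up to normalization
  (lemma \<open>exists_periodic_solution_iff_cycle_sum\<close>).

  It remains to see that this trace is the right-hand side of the criterion. Read \<open>i\<close> as the edge from
  \<open>i\<close> to \<open>i + 1\<close> of the cycle with vertices \<open>0, \<dots>, p - 1\<close>. Then \<open>\<Lambda>\<close> consists of the indicator functions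
  of the matchings of that cycle, and the summand of \<open>\<alpha>\<close>, with its sign, is the
  product of \<open>w\<close> over the matched edges and of \<open>b\<close> over the free vertices
  (lemma \<open>sum_Lam_eq_cycle_sum\<close>). Matchings of a path satisfy the three-term recurrence, by
  distinguishing whether the last vertex is free. Matchings of the cycle without
  the closing edge from \<open>p - 1\<close> to \<open>0\<close> are matchings of a path with \<open>p\<close> vertices and give \<open>K(p)\<close>; with
  that edge they are matchings of the path \<open>1, \<dots>, p - 2\<close> and give \<open>w(p-1) L(p-1)\<close>
  (lemma \<open>cycle_sum_eq_three_term\<close>).\<close>

section \<open>Matchings of paths and cycles\<close>

text \<open>Edges are named by their lower end point, so a matching is a set of numbers without two
  neighbours. The vertices of the path are \<open>l, \<dots>, n - 1\<close>.\<close>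

definition path_matchings :: "nat \<Rightarrow> nat \<Rightarrow> nat set set" where
  "path_matchings l n = {S. \<forall>i\<in>S. l \<le> i \<and> Suc i < n \<and> Suc i \<notin> S}"

definition path_sum :: "(nat \<Rightarrow> 'a::comm_ring_1) \<Rightarrow> (nat \<Rightarrow> 'a) \<Rightarrow> nat \<Rightarrow> nat \<Rightarrow> 'a" where
  "path_sum w b l n =
     (\<Sum>S\<in>path_matchings l n. prod w S * prod b ({l..<n} - (S \<union> Suc ` S)))"

text \<open>The edge \<open>p - 1\<close> closes the cycle. For \<open>p = 1\<close> it is a loop and the condition excludes it.\<close>

definition cycle_matchings :: "nat \<Rightarrow> nat set set" where
  "cycle_matchings p = {S. S \<subseteq> {..<p} \<and> (\<forall>i\<in>S. Suc i mod p \<notin> S)}"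

definition cycle_sum :: "(nat \<Rightarrow> 'a::comm_ring_1) \<Rightarrow> (nat \<Rightarrow> 'a) \<Rightarrow> nat \<Rightarrow> 'a" where
  "cycle_sum w b p =
     (\<Sum>S\<in>cycle_matchings p. prod w S * prod b ({..<p} - (S \<union> (\<lambda>i. Suc i mod p) ` S)))"

fun three_term :: "(nat \<Rightarrow> 'a::comm_ring_1) \<Rightarrow> (nat \<Rightarrow> 'a) \<Rightarrow> 'a \<Rightarrow> 'a \<Rightarrow> nat \<Rightarrow> 'a" where
  "three_term w b x y 0 = x"
| "three_term w b x y (Suc 0) = y"
| "three_term w b x y (Suc (Suc n)) =
     b (Suc n) * three_term w b x y (Suc n) + w n * three_term w b x y n"

lemma finite_path_matchings: "finite (path_matchings l n)"
proof (rule finite_subset)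
  show "path_matchings l n \<subseteq> Pow {..<n}"
    by (auto simp: path_matchings_def)
qed simp

lemma finite_mem_path_matchings: "S \<in> path_matchings l n \<Longrightarrow> finite S"
  by (rule finite_subset[of _ "{..<n}"]) (auto simp: path_matchings_def)

lemma finite_cycle_matchings: "finite (cycle_matchings p)"
  by (rule finite_subset[of _ "Pow {..<p}"]) (auto simp: cycle_matchings_def)

lemma path_sum_trivial:
  "path_sum w b l l = 1" "path_sum w b l (Suc l) = b l"
proof -
  have "path_matchings l l = {{}}" "path_matchings l (Suc l) = {{}}"
    by (auto simp: path_matchings_def)
  then show "path_sum w b l l = 1" "path_sum w b l (Suc l) = b l"
    by (simp_all add: path_sum_def)
qed

text \<open>The last edge \<open>n\<close> joins \<open>n\<close> and \<open>n + 1\<close>. Using it excludes the edge \<open>n - 1\<close>, so the rest is a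
  matching of the path that stops before the vertex \<open>n\<close>.\<close>

lemma path_matchings_Suc_Suc:
  assumes "l \<le> n"
  shows "path_matchings l (Suc (Suc n)) =
    path_matchings l (Suc n) \<union> insert n ` path_matchings l n"
proof (intro equalityI subsetI)
  fix S assume S: "S \<in> path_matchings l (Suc (Suc n))"
  show "S \<in> path_matchings l (Suc n) \<union> insert n ` path_matchings l n"
  proof (cases "n \<in> S")
    case True
    then have "S = insert n (S - {n})" by blast
    moreover have "S - {n} \<in> path_matchings l n"
      using S True unfolding path_matchings_def
      by (auto simp: less_Suc_eq)
    ultimately show ?thesis by blast
  next
    case False
    then show ?thesis using S unfolding path_matchings_def by (auto simp: less_Suc_eq)
  qed
next
  fix S assume "S \<in> path_matchings l (Suc n) \<union> insert n ` path_matchings l n"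
  then show "S \<in> path_matchings l (Suc (Suc n))"
    using assms unfolding path_matchings_def by fastforce
qed

text \<open>If the last vertex is free, it contributes a factor of \<open>b\<close>; otherwise it is matched with the
  last but one, and both vertices disappear.\<close>

lemma path_sum_Suc_Suc:
  assumes "l \<le> n"
  shows "path_sum w b l (Suc (Suc n)) = b (Suc n) * path_sum w b l (Suc n) + w n * path_sum w b l n"
proof -
  let ?f = "\<lambda>n S. prod w S * prod b ({l..<n} - (S \<union> Suc ` S))"
  have last_free: "?f (Suc (Suc n)) S = b (Suc n) * ?f (Suc n) S"
    if "S \<in> path_matchings l (Suc n)" for S
  proof -
    have "{l..<Suc (Suc n)} - (S \<union> Suc ` S) = insert (Suc n) ({l..<Suc n} - (S \<union> Suc ` S))"
      using that assms by (auto simp: path_matchings_def)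
    then show ?thesis by simp
  qed
  have last_matched: "?f (Suc (Suc n)) (insert n S) = w n * ?f n S"
    if "S \<in> path_matchings l n" for S
  proof -
    have "n \<notin> S" using that by (auto simp: path_matchings_def)
    moreover have "{l..<Suc (Suc n)} - (insert n S \<union> Suc ` insert n S) = {l..<n} - (S \<union> Suc ` S)"
      by auto
    ultimately show ?thesis using finite_mem_path_matchings[OF that] by (simp add: mult.assoc)
  qed
  have inj: "inj_on (insert n) (path_matchings l n)"
    by (rule inj_onI) (auto simp: path_matchings_def, (metis insert_iff less_irrefl Suc_lessD)+)
  have disj: "path_matchings l (Suc n) \<inter> insert n ` path_matchings l n = {}"
    by (auto simp: path_matchings_def)
  have "path_sum w b l (Suc (Suc n)) =
      (\<Sum>S\<in>path_matchings l (Suc n). ?f (Suc (Suc n)) S)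
      + (\<Sum>S\<in>path_matchings l n. ?f (Suc (Suc n)) (insert n S))"
    unfolding path_sum_def path_matchings_Suc_Suc[OF assms]
    by (subst sum.union_disjoint)
       (simp_all add: finite_path_matchings disj sum.reindex[OF inj])
  also have "\<dots> = b (Suc n) * path_sum w b l (Suc n) + w n * path_sum w b l n"
    unfolding path_sum_def sum_distrib_left
    by (intro arg_cong2[where f = "(+)"] sum.cong refl last_free last_matched)
  finally show ?thesis .
qed

text \<open>The second sequence has to start with the value \<open>0\<close> at \<open>n = 0\<close>, while the sum over the
  matchings of an empty path is \<open>1\<close>; therefore it is compared from \<open>n = 1\<close> on.\<close>

lemma three_term_eq_path_sum:
  "three_term w b 1 (b 0) n = path_sum w b 0 n"
  "three_term w b 0 1 (Suc n) = path_sum w b (Suc 0) (Suc n)"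
proof -
  show "three_term w b 1 (b 0) n = path_sum w b 0 n"
    by (induction n rule: induct_nat_012) (simp_all add: path_sum_trivial path_sum_Suc_Suc)
  show "three_term w b 0 1 (Suc n) = path_sum w b (Suc 0) (Suc n)"
    by (induction n rule: induct_nat_012)
       (simp_all add: path_sum_trivial path_sum_Suc_Suc del: One_nat_def)
qed

text \<open>Cutting the cycle at its closing edge: if that edge is used, its end points \<open>n + 1\<close> and \<open>0\<close>
  are covered, and the path on the vertices \<open>1, \<dots>, n\<close> remains.\<close>

lemma cycle_matchings_Suc_Suc:
  "cycle_matchings (Suc (Suc n)) =
    path_matchings 0 (Suc (Suc n)) \<union> insert (Suc n) ` path_matchings (Suc 0) (Suc n)"
proof (intro equalityI subsetI)
  fix S assume S: "S \<in> cycle_matchings (Suc (Suc n))"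
  then have sub: "\<And>i. i \<in> S \<Longrightarrow> i < Suc (Suc n)"
    and nonadj: "\<And>i. i \<in> S \<Longrightarrow> Suc i mod Suc (Suc n) \<notin> S"
    by (auto simp: cycle_matchings_def)
  have nonadj': "Suc i \<notin> S" if "i \<in> S" for i
    using nonadj[OF that] sub[of "Suc i"] by auto
  show "S \<in> path_matchings 0 (Suc (Suc n)) \<union> insert (Suc n) ` path_matchings (Suc 0) (Suc n)"
  proof (cases "Suc n \<in> S")
    case True
    then have "0 \<notin> S" using nonadj[OF True] by simp
    have "n \<notin> S" using nonadj' True by blast
    have "S - {Suc n} \<in> path_matchings (Suc 0) (Suc n)"
      unfolding path_matchings_def using sub nonadj' \<open>0 \<notin> S\<close> \<open>n \<notin> S\<close>
      by (auto simp: less_Suc_eq Suc_le_eq intro: gr0I)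
        (metis gr0I less_antisym not_less_eq sub)+
    moreover have "S = insert (Suc n) (S - {Suc n})" using True by blast
    ultimately show ?thesis by blast
  next
    case False
    have "i < Suc n" if "i \<in> S" for i
      using sub[OF that] that False by (cases "i = Suc n") auto
    then have "S \<in> path_matchings 0 (Suc (Suc n))"
      using nonadj' by (simp add: path_matchings_def)
    then show ?thesis by blast
  qed
next
  fix S assume "S \<in> path_matchings 0 (Suc (Suc n)) \<union> insert (Suc n) ` path_matchings (Suc 0) (Suc n)"
  then show "S \<in> cycle_matchings (Suc (Suc n))"
  proof
    assume "S \<in> path_matchings 0 (Suc (Suc n))"
    then show ?thesis unfolding path_matchings_def cycle_matchings_def by auto
  next
    assume "S \<in> insert (Suc n) ` path_matchings (Suc 0) (Suc n)"
    then obtain T where T: "S = insert (Suc n) T" "T \<in> path_matchings (Suc 0) (Suc n)" by blast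
    then have "\<And>i. i \<in> T \<Longrightarrow> Suc 0 \<le> i \<and> i < n \<and> Suc i \<notin> T"
      by (auto simp: path_matchings_def)
    then show ?thesis unfolding T(1) cycle_matchings_def by fastforce
  qed
qed

lemma cycle_sum_Suc_Suc:
  "cycle_sum w b (Suc (Suc n)) =
    path_sum w b 0 (Suc (Suc n)) + w (Suc n) * path_sum w b (Suc 0) (Suc n)"
proof -
  let ?p = "Suc (Suc n)"
  let ?V = "\<lambda>S. {..<?p} - (S \<union> (\<lambda>i. Suc i mod ?p) ` S)"
  have open_term: "?V S = {0..<?p} - (S \<union> Suc ` S)" if "S \<in> path_matchings 0 ?p" for S
  proof -
    have "(\<lambda>i. Suc i mod ?p) ` S = Suc ` S"
      using that by (intro image_cong) (auto simp: path_matchings_def)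
    then show ?thesis by (simp add: lessThan_atLeast0)
  qed
  have closing_term: "prod w (insert (Suc n) S) * prod b (?V (insert (Suc n) S)) =
      w (Suc n) * (prod w S * prod b ({Suc 0..<Suc n} - (S \<union> Suc ` S)))"
    if S: "S \<in> path_matchings (Suc 0) (Suc n)" for S
  proof -
    have "Suc n \<notin> S" using S by (auto simp: path_matchings_def)
    have "(\<lambda>i. Suc i mod ?p) ` S = Suc ` S"
      using S by (intro image_cong) (auto simp: path_matchings_def)
    then have "?V (insert (Suc n) S) = {Suc 0..<Suc n} - (S \<union> Suc ` S)"
      by auto
    then show ?thesis using \<open>Suc n \<notin> S\<close> finite_mem_path_matchings[OF S] by (simp add: mult.assoc)
  qed
  have inj: "inj_on (insert (Suc n)) (path_matchings (Suc 0) (Suc n))"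
    by (rule inj_onI) (auto simp: path_matchings_def, (metis insert_iff less_irrefl Suc_lessD)+)
  have disj: "path_matchings 0 ?p \<inter> insert (Suc n) ` path_matchings (Suc 0) (Suc n) = {}"
    by (auto simp: path_matchings_def)
  have "cycle_sum w b ?p =
      (\<Sum>S\<in>path_matchings 0 ?p. prod w S * prod b (?V S))
      + (\<Sum>S\<in>path_matchings (Suc 0) (Suc n).
           prod w (insert (Suc n) S) * prod b (?V (insert (Suc n) S)))"
    unfolding cycle_sum_def cycle_matchings_Suc_Suc
    by (subst sum.union_disjoint)
       (simp_all add: finite_path_matchings disj sum.reindex[OF inj])
  also have "\<dots> = path_sum w b 0 ?p + w (Suc n) * path_sum w b (Suc 0) (Suc n)"
    unfolding path_sum_def sum_distrib_left
    by (intro arg_cong2[where f = "(+)"] sum.cong refl closing_term) (simp add: open_term)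
  finally show ?thesis .
qed

text \<open>For \<open>n = 0\<close> the second term vanishes because the three-term sequence starts with \<open>0\<close>, in agreement
  with the absence of a closing edge on a cycle with one vertex.\<close>

lemma cycle_sum_eq_three_term:
  "cycle_sum w b (Suc n) = three_term w b 1 (b 0) (Suc n) + w n * three_term w b 0 1 n"
proof (cases n)
  case 0
  have "cycle_matchings (Suc 0) = {{}}"
    by (auto simp: cycle_matchings_def)
  then show ?thesis using 0 by (simp add: cycle_sum_def lessThan_Suc)
next
  case (Suc m)
  then show ?thesis
    by (simp only: cycle_sum_Suc_Suc three_term_eq_path_sum)
qed

section \<open>Linear algebra of the three-term recurrence\<close>

lemma three_term_linear:
  "three_term w b (r * x + s * x') (r * y + s * y') n =
     r * three_term w b x y n + s * three_term w b x' y' n"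
  by (induction n rule: induct_nat_012) (simp_all add: algebra_simps)

text \<open>The discrete Wronskian. Each step is a multiplication by the determinant of the
  transfer matrix, which is \<open>- w n\<close>; the contribution of \<open>b\<close> cancels.\<close>

lemma three_term_casoratian:
  "three_term w b x y n * three_term w b x' y' (Suc n)
     - three_term w b x y (Suc n) * three_term w b x' y' n
   = (\<Prod>i<n. - w i) * (x * y' - y * x')"
proof (induction n)
  case (Suc n)
  let ?u = "three_term w b x y" and ?v = "three_term w b x' y'"
  have "?u (Suc n) * ?v (Suc (Suc n)) - ?u (Suc (Suc n)) * ?v (Suc n)
      = - w n * (?u n * ?v (Suc n) - ?u (Suc n) * ?v n)"
    by (simp add: algebra_simps)
  then show ?case using Suc by simp
qed simp

lemma homogeneous_system_2x2:
  fixes \<alpha> \<beta> \<gamma> \<delta> :: "'a::field"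
  shows "(\<exists>x y. (x \<noteq> 0 \<or> y \<noteq> 0) \<and> \<alpha> * x + \<beta> * y = 0 \<and> \<gamma> * x + \<delta> * y = 0)
    \<longleftrightarrow> \<alpha> * \<delta> = \<beta> * \<gamma>"
proof
  assume "\<exists>x y. (x \<noteq> 0 \<or> y \<noteq> 0) \<and> \<alpha> * x + \<beta> * y = 0 \<and> \<gamma> * x + \<delta> * y = 0"
  then obtain x y where nz: "x \<noteq> 0 \<or> y \<noteq> 0"
    and eq: "\<alpha> * x + \<beta> * y = 0" "\<gamma> * x + \<delta> * y = 0" by blast
  have "(\<alpha> * \<delta> - \<beta> * \<gamma>) * x = \<delta> * (\<alpha> * x + \<beta> * y) - \<beta> * (\<gamma> * x + \<delta> * y)"
    "(\<alpha> * \<delta> - \<beta> * \<gamma>) * y = \<alpha> * (\<gamma> * x + \<delta> * y) - \<gamma> * (\<alpha> * x + \<beta> * y)"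
    by (simp_all add: algebra_simps)
  then show "\<alpha> * \<delta> = \<beta> * \<gamma>" using nz unfolding eq by auto
next
  assume det: "\<alpha> * \<delta> = \<beta> * \<gamma>"
  show "\<exists>x y. (x \<noteq> 0 \<or> y \<noteq> 0) \<and> \<alpha> * x + \<beta> * y = 0 \<and> \<gamma> * x + \<delta> * y = 0"
  \<comment> \<open>A non-zero row \<open>(\<alpha>, \<beta>)\<close> has the kernel spanned by \<open>(\<beta>, - \<alpha>)\<close>, and the other row is proportional to it.\<close>
  proof (cases "\<alpha> = 0 \<and> \<beta> = 0")
    case True
    show ?thesis
    proof (cases "\<gamma> = 0 \<and> \<delta> = 0")
      case True
      then show ?thesis using \<open>\<alpha> = 0 \<and> \<beta> = 0\<close> by (intro exI[of _ 1]) simp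
    next
      case False
      then show ?thesis using \<open>\<alpha> = 0 \<and> \<beta> = 0\<close>
        by (intro exI[of _ \<delta>] exI[of _ "- \<gamma>"]) (auto simp: algebra_simps)
    qed
  next
    case False
    then show ?thesis using det
      by (intro exI[of _ \<beta>] exI[of _ "- \<alpha>"]) (auto simp: algebra_simps)
  qed
qed

section \<open>Periodic solutions and the monodromy trace\<close>

lemma per_seq_add_period: "z \<in> per_seq p \<Longrightarrow> z (k + int p) = z k"
  by (simp add: per_seq_def)

lemma per_seq_mod:
  assumes "z \<in> per_seq p"
  shows "z (k mod int p) = z k"
proof -
  note step = per_seq_add_period[OF assms]
  have "z (k + i * int p) = z k" for i :: int and k
  proof (induction i rule: int_induct[of _ 0])
    case (step1 i)
    then show ?case using step[of "k + i * int p"] by (simp add: algebra_simps)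
  next
    case (step2 i)
    then show ?case using step[of "k + (i - 1) * int p"] by (simp add: algebra_simps)
  qed simp
  from this[of "k mod int p" "k div int p"] show ?thesis
    by (simp add: add.commute)
qed

text \<open>The product of the leading coefficients clears the denominators of the recurrence. The initial
  value at \<open>1\<close> comes from the equation at \<open>0\<close>, in which \<open>z (- 1)\<close> is a free parameter.\<close>

lemma scaled_solution_eq_three_term:
  fixes a b c z :: "int \<Rightarrow> 'a::comm_ring_1"
  assumes eq: "\<And>n. a (int n) * z (int n + 1) - b (int n) * z (int n) + c (int n - 1) * z (int n - 1) = 0"
  defines "w \<equiv> \<lambda>n. - (a (int n) * c (int n))"
  shows "(\<Prod>j<n. a (int j)) * z (int n) =
    three_term w (\<lambda>n. b (int n)) (z 0) (b 0 * z 0 - c (- 1) * z (- 1)) n"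
proof (induction n rule: induct_nat_012)
  case 1
  then show ?case using eq[of 0] by (simp add: algebra_simps)
next
  case (ge2 n)
  let ?A = "\<lambda>n. \<Prod>j<n. a (int j)"
  have "?A (Suc (Suc n)) * z (int (Suc (Suc n)))
      = ?A (Suc n) * (a (int (Suc n)) * z (int (Suc n) + 1))"
    by (simp add: add.commute mult.assoc)
  also have "a (int (Suc n)) * z (int (Suc n) + 1) = b (int (Suc n)) * z (int (Suc n)) - c (int n) * z (int n)"
    using eq[of "Suc n"] by (simp add: algebra_simps)
  also have "?A (Suc n) * \<dots> = b (int (Suc n)) * (?A (Suc n) * z (int (Suc n))) + w n * (?A n * z (int n))"
    by (simp add: w_def algebra_simps)
  finally show ?case by (simp only: ge2 three_term.simps)
qed simp

text \<open>A solution on one period extends periodically as soon as its values at \<open>p - 1\<close>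
  and \<open>p\<close> agree with those at \<open>- 1\<close> and \<open>0\<close>, because the recurrence has order
  two. So the existence of a periodic solution is a condition on the initial values \<open>x = z 0\<close>
  and \<open>y = z (- 1)\<close> only.\<close>

lemma exists_periodic_solution_iff_boundary:
  fixes a b c :: "int \<Rightarrow> 'a::field"
  assumes p: "1 \<le> p" and a: "a \<in> per_seq_nz p" and b: "b \<in> per_seq p" and c: "c \<in> per_seq p"
  defines "A \<equiv> \<lambda>n. \<Prod>j<n. a (int j)"
  defines "X \<equiv> \<lambda>x y. three_term (\<lambda>n. - (a (int n) * c (int n))) (\<lambda>n. b (int n)) x (b 0 * x - c (- 1) * y)"
  shows "(\<exists>z \<in> per_seq p. z \<noteq> (\<lambda>_. 0) \<and>
            (\<forall>k. a k * z (k + 1) - b k * z k + c (k - 1) * z (k - 1) = 0))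
    \<longleftrightarrow> (\<exists>x y. (x \<noteq> 0 \<or> y \<noteq> 0) \<and> X x y p = A p * x \<and> X x y (p - 1) = A (p - 1) * y)"
    (is "?L \<longleftrightarrow> ?R")
proof
  have nz: "a k \<noteq> 0" for k using a by (simp add: per_seq_nz_def)
  have A_nz: "A n \<noteq> 0" for n by (simp add: A_def nz)
  have pm1: "int (p - 1) = int p - 1" using p by simp
  {
    assume ?L
    then obtain z where z: "z \<in> per_seq p" "z \<noteq> (\<lambda>_. 0)"
      and eq: "\<And>k. a k * z (k + 1) - b k * z k + c (k - 1) * z (k - 1) = 0" by blast
    have X: "A n * z (int n) = X (z 0) (z (- 1)) n" for n
      unfolding A_def X_def by (rule scaled_solution_eq_three_term) (rule eq)
    note per = per_seq_add_period[OF z(1)]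
    \<comment> \<open>Zero initial values propagate to all natural numbers and from there by periodicity to all integers.\<close>
    have "z 0 \<noteq> 0 \<or> z (- 1) \<noteq> 0"
    proof (rule ccontr)
      assume "\<not> (z 0 \<noteq> 0 \<or> z (- 1) \<noteq> 0)"
      then have "X (z 0) (z (- 1)) n = 0" for n
        unfolding X_def by (induction n rule: induct_nat_012) simp_all
      then have nonneg: "z (int n) = 0" for n using X[of n] A_nz[of n] by simp
      have "z k = 0" for k
        using nonneg[of "nat (k mod int p)"] p per_seq_mod[OF z(1), of k] by simp
      then show False using z(2) by auto
    qed
    moreover have "X (z 0) (z (- 1)) p = A p * z 0"
      using X[of p] per[of 0] by simp
    moreover have "X (z 0) (z (- 1)) (p - 1) = A (p - 1) * z (- 1)"
      using X[of "p - 1"] per[of "- 1"] unfolding pm1 by simp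
    ultimately show ?R by blast
  next
    assume ?R
    then obtain x y where xy: "x \<noteq> 0 \<or> y \<noteq> 0"
      and close: "X x y p = A p * x" "X x y (p - 1) = A (p - 1) * y" by blast
    define Z where "Z n = X x y n / A n" for n
    have Z_close: "Z 0 = x" "Z p = x" "Z (p - 1) = y"
      using close A_nz by (simp_all add: Z_def, simp add: X_def A_def)
    have Z_0: "a 0 * Z (Suc 0) - b 0 * Z 0 + c (- 1) * y = 0"
      using nz by (simp add: Z_def X_def A_def)
    have Z_Suc: "a (int (Suc n)) * Z (Suc (Suc n)) - b (int (Suc n)) * Z (Suc n) + c (int n) * Z n = 0" for n
    proof -
      have A_Suc: "A (Suc m) = A m * a (int m)" for m by (simp add: A_def)
      have X_Z: "X x y m = A m * Z m" for m using A_nz[of m] by (simp add: Z_def)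
      have "X x y (Suc (Suc n)) = b (int (Suc n)) * X x y (Suc n) - a (int n) * c (int n) * X x y n"
        by (simp add: X_def)
      then have "A (Suc n) * (a (int (Suc n)) * Z (Suc (Suc n)) - b (int (Suc n)) * Z (Suc n)
          + c (int n) * Z n) = 0"
        unfolding X_Z A_Suc by (simp only: mult_ac ring_distribs) simp
      then show ?thesis using A_nz[of "Suc n"] by simp
    qed
    \<comment> \<open>The closing conditions give the periodic extension the value \<open>Z p\<close> at \<open>p\<close> and \<open>y\<close> at \<open>- 1\<close>,
      the two places where an equation with index in \<open>{0..<p}\<close> leaves that range.\<close>
    define z where "z k = Z (nat (k mod int p))" for k
    have z_per: "z \<in> per_seq p" by (simp add: per_seq_def z_def)
    have z_Z: "z (int n) = Z n" if "n \<le> p" for n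
      using that Z_close by (cases "n = p") (simp_all add: z_def)
    have z_neg: "z (- 1) = y"
    proof -
      have "z (- 1) = z (- 1 + int p)" by (rule per_seq_add_period[OF z_per, symmetric])
      also have "\<dots> = y" using z_Z[of "p - 1"] Z_close(3) unfolding pm1 by simp
      finally show ?thesis .
    qed
    have base: "a (int n) * z (int n + 1) - b (int n) * z (int n) + c (int n - 1) * z (int n - 1) = 0"
      if "n < p" for n
    proof (cases n)
      case 0
      then show ?thesis using Z_0 z_Z[of 0] z_Z[of 1] z_neg p by simp
    next
      case (Suc m)
      then show ?thesis
        using Z_Suc[of m] z_Z[of m] z_Z[of n] z_Z[of "Suc n"] that by (simp add: add.commute)
    qed
    have shift: "f ((k mod int p) + i) = f (k + i)" if "f \<in> per_seq p" for f :: "int \<Rightarrow> 'a" and k i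
      using per_seq_mod[OF that, of "k mod int p + i"] per_seq_mod[OF that, of "k + i"]
      by (simp add: mod_add_left_eq)
    have "a k * z (k + 1) - b k * z k + c (k - 1) * z (k - 1) = 0" for k
    proof -
      define n where "n = nat (k mod int p)"
      have n: "n < p" "int n = k mod int p" using p by (simp_all add: n_def nat_less_iff)
      have "a \<in> per_seq p" using a by (simp add: per_seq_nz_def)
      then show ?thesis
        using base[OF n(1)] shift[of a k 0] shift[OF z_per, of k 1] shift[OF z_per, of k 0]
          shift[OF z_per, of k "- 1"] shift[OF b, of k 0] shift[OF c, of k "- 1"]
        by (simp add: n(2))
    qed
    moreover have "z \<noteq> (\<lambda>_. 0)"
      using xy z_Z[of 0] z_neg Z_close by (metis of_nat_0 le0)
    ultimately show ?L using z_per by blast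
  }
qed

text \<open>The periodicity conditions form a homogeneous linear system in the two initial values, and the
  criterion says that its determinant vanishes. The terms of the determinant that are quadratic in
  the two fundamental solutions form their Casoratian, which is a product of values of \<open>a\<close> and \<open>c\<close>.\<close>

lemma exists_periodic_solution_iff_cycle_sum:
  fixes a b c :: "int \<Rightarrow> 'a::field"
  assumes p: "1 \<le> p" and a: "a \<in> per_seq_nz p" and b: "b \<in> per_seq p" and c: "c \<in> per_seq p"
  shows "(\<exists>z \<in> per_seq p. z \<noteq> (\<lambda>_. 0) \<and>
            (\<forall>k. a k * z (k + 1) - b k * z k + c (k - 1) * z (k - 1) = 0))
    \<longleftrightarrow> (\<Prod>j<p. a (int j)) + (\<Prod>j<p. c (int j)) =
        cycle_sum (\<lambda>n. - (a (int n) * c (int n))) (\<lambda>n. b (int n)) p"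
proof -
  define q where "q = p - 1"
  have pq: "p = Suc q" using p by (simp add: q_def)
  define w where "w = (\<lambda>n. - (a (int n) * c (int n)))"
  define A where "A n = (\<Prod>j<n. a (int j))" for n
  define C where "C n = (\<Prod>j<n. c (int j))" for n
  define K where "K = three_term w (\<lambda>n. b (int n)) 1 (b 0)"
  define L where "L = three_term w (\<lambda>n. b (int n)) 0 1"
  define d where "d = c (- 1)"
  have d: "d = c (int q)"
  proof -
    have "c (- 1) = c (- 1 + int p)" by (rule per_seq_add_period[OF c, symmetric])
    also have "- 1 + int p = int q" by (simp add: pq)
    finally show ?thesis unfolding d_def .
  qed
  have nz: "A n \<noteq> 0" "a k \<noteq> 0" for n k using a by (simp_all add: A_def per_seq_nz_def)
  have X: "three_term w (\<lambda>n. b (int n)) x (b 0 * x - c (- 1) * y) n = x * K n - d * y * L n" for x y n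
    using three_term_linear[of w "\<lambda>n. b (int n)" x 1 "- (d * y)" 0 "b 0" 1 n]
    by (simp add: K_def L_def d_def mult.commute)
  have "(\<exists>z \<in> per_seq p. z \<noteq> (\<lambda>_. 0) \<and>
            (\<forall>k. a k * z (k + 1) - b k * z k + c (k - 1) * z (k - 1) = 0))
    \<longleftrightarrow> (\<exists>x y. (x \<noteq> 0 \<or> y \<noteq> 0) \<and> x * K p - d * y * L p = A p * x
              \<and> x * K q - d * y * L q = A q * y)"
    using exists_periodic_solution_iff_boundary[OF p a b c]
    unfolding w_def[symmetric] A_def[symmetric] X q_def[symmetric] .
  also have "\<dots> \<longleftrightarrow> (\<exists>x y. (x \<noteq> 0 \<or> y \<noteq> 0) \<and> (K p - A p) * x + (- d * L p) * y = 0
              \<and> K q * x + (- d * L q - A q) * y = 0)"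
    by (simp add: algebra_simps)
  also have "\<dots> \<longleftrightarrow> (K p - A p) * (- d * L q - A q) = - d * L p * K q"
    by (rule homogeneous_system_2x2)
  also have "\<dots> \<longleftrightarrow> A p * (A p + C p - (K p + w q * L q)) = 0"
  proof -
    have AC: "(\<Prod>i<q. - w i) = A q * C q"
      by (simp add: w_def A_def C_def prod.distrib)
    have cas: "K q * L p - K p * L q = A q * C q"
      using three_term_casoratian[of w "\<lambda>n. b (int n)" 1 "b 0" q 0 1]
      by (simp add: K_def L_def pq AC)
    have Ap: "A p = A q * a (int q)" and Cp: "C p = C q * d"
      by (simp_all add: A_def C_def pq d)
    have wq: "w q = - (a (int q) * d)" by (simp add: w_def d)
    \<comment> \<open>The factor \<open>a (int q)\<close> completes \<open>d\<close> to \<open>- w q\<close> and \<open>A q\<close> to \<open>A p\<close>, so that \<open>A p\<close> splits off.\<close>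
    have "a (int q) * ((K p - A p) * (- d * L q - A q) - (- d * L p * K q))
        = a (int q) * d * (K q * L p - K p * L q) + A p * A p - A p * (K p + w q * L q)"
      by (simp add: Ap wq algebra_simps)
    also have "\<dots> = A p * (A p + C p - (K p + w q * L q))"
      unfolding cas by (simp add: Ap Cp algebra_simps)
    finally have "a (int q) * ((K p - A p) * (- d * L q - A q) - (- d * L p * K q))
        = A p * (A p + C p - (K p + w q * L q))" .
    then show ?thesis using nz(2)[of "int q"] by (metis eq_iff_diff_eq_0 mult_eq_0_iff)
  qed
  also have "\<dots> \<longleftrightarrow> A p + C p = cycle_sum w (\<lambda>n. b (int n)) p"
    using nz(1)[of p] by (simp add: pq K_def L_def cycle_sum_eq_three_term)
  finally show ?thesis unfolding A_def C_def w_def .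
qed

section \<open>Multi-indices as matchings of a cycle\<close>

text \<open>The edges of a matching have distinct lower and distinct upper end points, and all of these are different
  from each other. This is why the sum in the criterion may stop at \<open>p div 2\<close>.\<close>

lemma card_cycle_matching_le:
  assumes "S \<in> cycle_matchings p"
  shows "card S \<le> p div 2"
proof -
  let ?s = "\<lambda>i. Suc i mod p"
  have S: "S \<subseteq> {..<p}" "\<And>i. i \<in> S \<Longrightarrow> ?s i \<notin> S"
    using assms by (auto simp: cycle_matchings_def)
  have fin: "finite S" using S(1) finite_subset by blast
  have "inj_on ?s {..<p}"
    by (rule inj_onI) (auto simp: mod_Suc split: if_splits)
  then have inj: "inj_on ?s S" using S(1) inj_on_subset by blast
  have "S \<union> ?s ` S \<subseteq> {..<p}"
    using S(1) by auto
  then have "card (S \<union> ?s ` S) \<le> p"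
    using card_mono[of "{..<p}"] by simp
  moreover have "card (S \<union> ?s ` S) = card S + card S"
    using S(2) fin by (subst card_Un_disjoint) (auto simp: card_image[OF inj])
  ultimately show ?thesis by simp
qed

definition mi_of_set :: "nat \<Rightarrow> nat set \<Rightarrow> nat \<Rightarrow> nat" where
  "mi_of_set p S = (\<lambda>i\<in>{..<p}. if i \<in> S then 1 else 0)"

lemma bij_betw_mi_of_set: "bij_betw (mi_of_set p) (Pow {..<p}) (multi_index p)"
proof (rule bij_betw_byWitness[where f' = "\<lambda>\<alpha>. {i. i < p \<and> \<alpha> i = 1}"])
  show "\<forall>\<alpha>\<in>multi_index p. mi_of_set p {i. i < p \<and> \<alpha> i = 1} = \<alpha>"
  proof
    fix \<alpha> assume \<alpha>: "\<alpha> \<in> multi_index p"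
    show "mi_of_set p {i. i < p \<and> \<alpha> i = 1} = \<alpha>"
    proof
      fix i show "mi_of_set p {i. i < p \<and> \<alpha> i = 1} i = \<alpha> i"
        using \<alpha> by (cases "i < p") (auto simp: mi_of_set_def multi_index_def PiE_def extensional_def Pi_def)
    qed
  qed
qed (auto simp: mi_of_set_def multi_index_def split: if_splits)

lemma mi_of_set_facts:
  assumes "S \<subseteq> {..<p}"
  shows "mi_supp p (mi_of_set p S) = sorted_list_of_set S"
    and "mi_abs p (mi_of_set p S) = card S"
    and "mi_power p a (mi_of_set p S) = (\<Prod>i\<in>S. a (int i))"
    and "mi_power p a (mi_bar p (mi_of_set p S)) =
      (\<Prod>i\<in>{..<p} - (S \<union> (\<lambda>i. Suc i mod p) ` S). a (int i))"
proof -
  have fin: "finite S" using assms finite_subset by blast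
  have supp: "{i. i < p \<and> mi_of_set p S i = 1} = S"
    using assms by (auto simp: mi_of_set_def)
  then show supp': "mi_supp p (mi_of_set p S) = sorted_list_of_set S"
    by (simp add: mi_supp_def)
  have int: "{..<p} \<inter> S = S" using assms by auto
  show "mi_abs p (mi_of_set p S) = card S"
    by (simp add: mi_abs_def mi_of_set_def sum.If_cases int)
  have "mi_power p a (mi_of_set p S) = (\<Prod>i<p. if i \<in> S then a (int i) else 1)"
    unfolding mi_power_def by (intro prod.cong) (auto simp: mi_of_set_def)
  then show "mi_power p a (mi_of_set p S) = (\<Prod>i\<in>S. a (int i))"
    by (simp add: prod.If_cases int)
  let ?V = "S \<union> (\<lambda>i. Suc i mod p) ` S"
  have "mi_power p a (mi_bar p (mi_of_set p S)) = (\<Prod>i<p. if i \<in> ?V then 1 else a (int i))"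
    unfolding mi_power_def
    by (intro prod.cong) (auto simp: mi_bar_def supp' fin)
  also have "\<dots> = (\<Prod>i\<in>{..<p} - ?V. a (int i))"
    unfolding Diff_eq by (simp add: prod.If_cases Diff_eq Compl_eq)
  finally show "mi_power p a (mi_bar p (mi_of_set p S)) = (\<Prod>i\<in>{..<p} - ?V. a (int i))" .
qed

lemma sorted_gaps_iff:
  fixes xs :: "nat list"
  assumes "sorted_wrt (<) xs"
  shows "(\<forall>j. j + 1 < length xs \<longrightarrow> xs ! j + 2 \<le> xs ! (j + 1)) \<longleftrightarrow> (\<forall>i\<in>set xs. Suc i \<notin> set xs)"
proof
  assume gaps: "\<forall>j. j + 1 < length xs \<longrightarrow> xs ! j + 2 \<le> xs ! (j + 1)"
  show "\<forall>i\<in>set xs. Suc i \<notin> set xs"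
  proof (intro ballI notI)
    fix i assume "i \<in> set xs" "Suc i \<in> set xs"
    then obtain j k where j: "j < length xs" "xs ! j = i" and k: "k < length xs" "xs ! k = Suc i"
      by (auto simp: in_set_conv_nth)
    have "j < k"
      using sorted_wrt_nth_less[OF assms, of k j] j k by (cases j k rule: linorder_cases) auto
    then have "xs ! (j + 1) \<le> xs ! k"
      using sorted_wrt_nth_less[OF assms, of "j + 1" k] k by (cases "j + 1 = k") auto
    moreover have "xs ! j + 2 \<le> xs ! (j + 1)" using gaps \<open>j < k\<close> k(1) by simp
    ultimately show False using j(2) k(2) by simp
  qed
next
  assume nonadj: "\<forall>i\<in>set xs. Suc i \<notin> set xs"
  show "\<forall>j. j + 1 < length xs \<longrightarrow> xs ! j + 2 \<le> xs ! (j + 1)"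
  proof (intro allI impI)
    fix j assume j: "j + 1 < length xs"
    then have "xs ! j < xs ! (j + 1)" using sorted_wrt_nth_less[OF assms, of j "j + 1"] by simp
    moreover have "xs ! (j + 1) \<noteq> Suc (xs ! j)"
      using nonadj j by (metis add_lessD1 nth_mem)
    ultimately show "xs ! j + 2 \<le> xs ! (j + 1)" by simp
  qed
qed

text \<open>Adjacency modulo \<open>p\<close> is ordinary adjacency together with the wrap-around from \<open>p - 1\<close> to
  \<open>0\<close>. In this form the condition can be read off from the increasing list of positions.\<close>

lemma mem_cycle_matchings_iff:
  assumes S: "S \<subseteq> {..<p}"
  shows "S \<in> cycle_matchings p \<longleftrightarrow> (\<forall>i\<in>S. Suc i \<notin> S) \<and> (0 \<in> S \<longrightarrow> p - 1 \<notin> S)"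
proof -
  have "Suc i mod p \<notin> S \<longleftrightarrow> Suc i \<notin> S \<and> (0 \<in> S \<longrightarrow> i \<noteq> p - 1)" if "i \<in> S" for i
  proof (cases "Suc i = p")
    case True
    then show ?thesis using S by auto
  next
    case False
    then show ?thesis using S that by (auto simp: subset_iff)
  qed
  then show ?thesis using S unfolding cycle_matchings_def by blast
qed

text \<open>The gap condition in the definition of \<open>\<Lambda>\<close> excludes ordinary neighbours, and the condition on
  the first and last position excludes the wrap-around. For \<open>m = 1\<close> both hold trivially, since \<open>p \<ge> 2\<close>.\<close>

lemma Lam_eq_image:
  assumes "m \<le> p div 2"
  shows "Lam p m = mi_of_set p ` {S \<in> cycle_matchings p. card S = m}"
proof -
  let ?M = "{S \<in> Pow {..<p}. card S = m \<and> S \<in> cycle_matchings p}"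
  have M: "{S \<in> cycle_matchings p. card S = m} = ?M"
    by (auto simp: cycle_matchings_def)
  have multi_index: "{\<alpha> \<in> multi_index p. P \<alpha>} = mi_of_set p ` {S \<in> Pow {..<p}. P (mi_of_set p S)}"
    for P
    unfolding bij_betw_imp_surj_on[OF bij_betw_mi_of_set[of p], symmetric] by blast
  consider "m = 0" | "m = 1" "2 \<le> p" | "2 \<le> m"
    using assms by linarith
  then show ?thesis
  proof cases
    case 1
    have "?M = {{}}"
      using 1 finite_subset[OF _ finite_lessThan[of p]] by (auto simp: cycle_matchings_def)
    moreover have "mi_of_set p {} = mi_zero p"
      by (simp add: mi_of_set_def mi_zero_def)
    ultimately show ?thesis using 1 M by (simp add: Lam_def)
  next
    case 2
    have "Lam p m = mi_of_set p ` {S \<in> Pow {..<p}. mi_abs p (mi_of_set p S) = 1}"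
      using 2 by (simp add: Lam_def multi_index)
    also have "{S \<in> Pow {..<p}. mi_abs p (mi_of_set p S) = 1} = ?M"
    proof (rule Collect_cong, rule conj_cong, rule refl)
      fix S assume S: "S \<in> Pow {..<p}"
      have "S \<in> cycle_matchings p" if "card S = 1"
      proof -
        obtain i where i: "S = {i}" using \<open>card S = 1\<close> card_1_singletonE by blast
        then show ?thesis using S 2(2) by (subst mem_cycle_matchings_iff) auto
      qed
      then show "mi_abs p (mi_of_set p S) = 1 \<longleftrightarrow> card S = m \<and> S \<in> cycle_matchings p"
        using S 2(1) by (auto simp: mi_of_set_facts)
    qed
    finally show ?thesis unfolding M .
  next
    case 3
    let ?P = "\<lambda>\<alpha>. mi_abs p \<alpha> = m \<and>
          (\<forall>j. j + 1 < m \<longrightarrow> mi_supp p \<alpha> ! j + 2 \<le> mi_supp p \<alpha> ! (j + 1)) \<and>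
          (mi_supp p \<alpha> ! 0 = 0 \<longrightarrow> mi_supp p \<alpha> ! (m - 1) + 2 \<le> p)"
    have "Lam p m = mi_of_set p ` {S \<in> Pow {..<p}. ?P (mi_of_set p S)}"
      using 3 assms by (simp only: Lam_def multi_index[of ?P]) simp
    also have "{S \<in> Pow {..<p}. ?P (mi_of_set p S)} = ?M"
    proof (rule Collect_cong, rule conj_cong, rule refl)
      fix S assume "S \<in> Pow {..<p}"
      then have S: "S \<subseteq> {..<p}" and fin: "finite S" using finite_subset by auto
      define xs where "xs = sorted_list_of_set S"
      have xs: "sorted_wrt (<) xs" "set xs = S" "length xs = card S"
        using fin by (simp_all add: xs_def)
      \<comment> \<open>The first and the last entry of the list are the minimum and the maximum of \<open>S\<close>.\<close>
      have wrap: "(xs ! 0 = 0 \<longrightarrow> xs ! (m - 1) + 2 \<le> p) \<longleftrightarrow> (0 \<in> S \<longrightarrow> p - 1 \<notin> S)"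
        if "card S = m"
      proof -
        have m: "0 < length xs" "m - 1 < length xs" "length xs = m" using that xs(3) 3 by auto
        have first: "xs ! 0 \<le> i" and last: "i \<le> xs ! (m - 1)" if "i \<in> S" for i
        proof -
          obtain j where j: "j < m" "i = xs ! j"
            using \<open>i \<in> S\<close> xs(2) m(3) by (metis in_set_conv_nth)
          show "xs ! 0 \<le> i"
            using sorted_wrt_nth_less[OF xs(1), of 0 j] j m by (cases "j = 0") auto
          show "i \<le> xs ! (m - 1)"
            using sorted_wrt_nth_less[OF xs(1), of j "m - 1"] j m
            by (cases "j = m - 1") (auto simp: less_imp_le)
        qed
        have mem: "xs ! 0 \<in> S" "xs ! (m - 1) \<in> S" using m xs(2) nth_mem by blast+
        have "xs ! 0 = 0 \<longleftrightarrow> 0 \<in> S" using first[of 0] mem by auto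
        moreover have "xs ! (m - 1) + 2 \<le> p \<longleftrightarrow> p - 1 \<notin> S"
        proof -
          have "xs ! (m - 1) < p" using mem S by auto
          moreover have "p - 1 \<in> S \<longleftrightarrow> xs ! (m - 1) = p - 1"
            using last[of "p - 1"] mem calculation by auto
          ultimately show ?thesis by auto
        qed
        ultimately show ?thesis by simp
      qed
      show "?P (mi_of_set p S) \<longleftrightarrow> card S = m \<and> S \<in> cycle_matchings p"
        using sorted_gaps_iff[OF xs(1)] wrap
        unfolding mi_of_set_facts(1,2)[OF S] mem_cycle_matchings_iff[OF S] xs_def[symmetric] xs(2,3)
        by (cases "card S = m") simp_all
    qed
    finally show ?thesis unfolding M .
  qed
qed

text \<open>The outer index is the number of matched edges, whose signs \<open>(- 1) ^ j\<close> are absorbed in the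
  edge weights \<open>- a c\<close>; the complementary multi-index selects the free vertices.\<close>

lemma sum_Lam_eq_cycle_sum:
  fixes a b c :: "int \<Rightarrow> 'a::comm_ring_1"
  shows "(\<Sum>j = 0..p div 2. (- 1) ^ j *
      (\<Sum>\<alpha> \<in> Lam p j. mi_power p a \<alpha> * mi_power p b (mi_bar p \<alpha>) * mi_power p c \<alpha>)) =
    cycle_sum (\<lambda>n. - (a (int n) * c (int n))) (\<lambda>n. b (int n)) p"
proof -
  let ?M = "cycle_matchings p"
  let ?g = "\<lambda>S. (\<Prod>i\<in>S. - (a (int i) * c (int i)))
      * (\<Prod>i\<in>{..<p} - (S \<union> (\<lambda>i. Suc i mod p) ` S). b (int i))"
  have "(- 1) ^ j * (\<Sum>\<alpha> \<in> Lam p j. mi_power p a \<alpha> * mi_power p b (mi_bar p \<alpha>) * mi_power p c \<alpha>)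
      = (\<Sum>S\<in>{S \<in> ?M. card S = j}. ?g S)" if "j \<in> {0..p div 2}" for j
  proof -
    have sub: "{S \<in> ?M. card S = j} \<subseteq> Pow {..<p}" by (auto simp: cycle_matchings_def)
    then have inj: "inj_on (mi_of_set p) {S \<in> ?M. card S = j}"
      using bij_betw_mi_of_set[of p] by (auto simp: bij_betw_def intro: inj_on_subset)
    have "(- 1) ^ j * (mi_power p a (mi_of_set p S) * mi_power p b (mi_bar p (mi_of_set p S))
        * mi_power p c (mi_of_set p S)) = ?g S" if "S \<in> {S \<in> ?M. card S = j}" for S
    proof -
      have S: "S \<subseteq> {..<p}" "card S = j" using that sub by auto
      have "(\<Prod>i\<in>S. - (a (int i) * c (int i))) = (\<Prod>i\<in>S. (- 1) * (a (int i) * c (int i)))" by simp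
      also have "\<dots> = (- 1) ^ j * ((\<Prod>i\<in>S. a (int i)) * (\<Prod>i\<in>S. c (int i)))"
        unfolding prod.distrib by (simp add: S(2))
      finally show ?thesis by (simp add: mi_of_set_facts[OF S(1)] mult_ac)
    qed
    then show ?thesis
      using that unfolding sum_distrib_left
      by (simp add: Lam_eq_image sum.reindex[OF inj] del: mem_Collect_eq)
  qed
  then have "(\<Sum>j = 0..p div 2. (- 1) ^ j *
      (\<Sum>\<alpha> \<in> Lam p j. mi_power p a \<alpha> * mi_power p b (mi_bar p \<alpha>) * mi_power p c \<alpha>))
      = (\<Sum>j = 0..p div 2. \<Sum>S\<in>{S \<in> ?M. card S = j}. ?g S)"
    by (rule sum.cong[OF refl])
  also have "\<dots> = (\<Sum>S\<in>?M. ?g S)"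
    using card_cycle_matching_le by (intro sum.group finite_cycle_matchings) auto
  finally show ?thesis by (simp add: cycle_sum_def)
qed

section \<open>The periodicity criterion\<close>

text \<open>The argument is valid over every field, which covers the real and the complex case at once.\<close>

lemma exists_periodic_solution_iff_Lam:
  fixes a b c :: "int \<Rightarrow> 'a::field"
  assumes "1 \<le> p" "a \<in> per_seq_nz p" "b \<in> per_seq p" "c \<in> per_seq p"
  shows "(\<exists>z \<in> per_seq p. z \<noteq> (\<lambda>_. 0) \<and>
            (\<forall>k. a k * z (k + 1) - b k * z k + c (k - 1) * z (k - 1) = 0))
    \<longleftrightarrow> mi_power p a (mi_ones p) + mi_power p c (mi_ones p) =
           (\<Sum>j = 0..p div 2. (-1) ^ j *
              (\<Sum>\<alpha> \<in> Lam p j. mi_power p a \<alpha> * mi_power p b (mi_bar p \<alpha>) * mi_power p c \<alpha>))"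
proof -
  have "mi_power p f (mi_ones p) = (\<Prod>j<p. f (int j))" for f :: "int \<Rightarrow> 'a"
    by (simp add: mi_power_def mi_ones_def)
  then show ?thesis
    using exists_periodic_solution_iff_cycle_sum[OF assms] by (simp add: sum_Lam_eq_cycle_sum)
qed

theorem corollary4p8:
  fixes p :: nat
  assumes "1 \<le> p"
  shows
    "(\<forall>a b c :: int \<Rightarrow> real.
        a \<in> per_seq_nz p \<longrightarrow> c \<in> per_seq_nz p \<longrightarrow> b \<in> per_seq p \<longrightarrow>
        ((\<exists>z \<in> per_seq p. z \<noteq> (\<lambda>_. 0) \<and>
            (\<forall>k. a k * z (k + 1) - b k * z k + c (k - 1) * z (k - 1) = 0))
         \<longleftrightarrow>
         mi_power p a (mi_ones p) + mi_power p c (mi_ones p) =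
           (\<Sum>j = 0..p div 2. (-1) ^ j *
              (\<Sum>\<alpha> \<in> Lam p j. mi_power p a \<alpha> * mi_power p b (mi_bar p \<alpha>) * mi_power p c \<alpha>))))
     \<and>
     (\<forall>a b c :: int \<Rightarrow> complex.
        a \<in> per_seq_nz p \<longrightarrow> c \<in> per_seq_nz p \<longrightarrow> b \<in> per_seq p \<longrightarrow>
        ((\<exists>z \<in> per_seq p. z \<noteq> (\<lambda>_. 0) \<and>
            (\<forall>k. a k * z (k + 1) - b k * z k + c (k - 1) * z (k - 1) = 0))
         \<longleftrightarrow>
         mi_power p a (mi_ones p) + mi_power p c (mi_ones p) =
           (\<Sum>j = 0..p div 2. (-1) ^ j *
              (\<Sum>\<alpha> \<in> Lam p j. mi_power p a \<alpha> * mi_power p b (mi_bar p \<alpha>) * mi_power p c \<alpha>))))"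
  by (intro conjI allI impI exists_periodic_solution_iff_Lam assms) (simp_all add: per_seq_nz_def)

end
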